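(* Let $m$ be an odd positive integer, let $D\subset\mathbb{C}$ be open and symmetric, and let $f=\mathcal{I}(F_0+\iota F_1)\in\mathcal{SR}(\Omega_D)$ be a slice regular function on $\Omega_D\subset\mathbb{R}^{m+1}$. Then for every integer $k\ge 1$ and every $x=\alpha+J\beta\in\Omega_D\setminus\mathbb{R}$ (with $\alpha=x_0$, $\beta=\sqrt{x_1^2+\dots+x_m^2}$), $$\Delta_{m+1}^k f'_s(x)=(m-3)(m-5)\cdots(m-2k-1)\sum_{j=1}^{k}a_j^{(k)}\beta^{j-2k}\,\partial_\beta^j f'_s(x),$$ or equivalently $$\Delta_{m+1}^k f'_s(x)=(m-3)(m-5)\cdots(m-2k-1)\sum_{j=1}^{k+1}a_j^{(k+1)}\beta^{j-2k-2}\,\partial_\beta^{j-1}F_1(\alpha+i\beta),$$ where $$a_j^{(k)}:=\frac{(2k-j-1)!}{(j-1)!\,(k-j)!\,(-2)^{k-j}}\qquad(1\le j\le k).$$ In particular, $f'_s$ is $\gamma_m$-polyharmonic, i.e. $\Delta_{m+1}^{\gamma_m}f'_s=0$, where $\gamma_m=\frac{m-1}{2}$.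
   Context: $\mathbb{R}_m$ is the real Clifford algebra generated by $e_1,\dots,e_m$ with $e_ie_j+e_je_i=-2\delta_{ij}$. The space $\mathbb{R}^{m+1}$ is identified with the paravectors $x=x_0+\sum_{i=1}^m x_ie_i\in\mathbb{R}_m$, and $\mathbb{R}$ with $\{x: x_1=\dots=x_m=0\}$. $\mathbb{S}=\{x\in\mathbb{R}^{m+1}:x_0=0,\ x_1^2+\dots+x_m^2=1\}$, so $J^2=-1$ for $J\in\mathbb{S}$. Every $x\in\mathbb{R}^{m+1}$ is $x=\alpha+J\beta$ with $\alpha=x_0$, $\beta=\sqrt{x_1^2+\dots+x_m^2}\ge 0$, $J\in\mathbb{S}$ ($J$ unique if $\beta>0$). $D\subset\mathbb{C}$ is symmetric if it is invariant under complex conjugation; $\Omega_D=\{\alpha+J\beta:\alpha+i\beta\in D,\ J\in\mathbb{S}\}\subset\mathbb{R}^{m+1}$. A stem function on $D$ is $F=F_0+\iota F_1:D\to\mathbb{R}_m\otimes\mathbb{R}^2$ ($\{1,\iota\}$ basis of $\mathbb{R}^2$, $\iota^2=-1$, $\iota$ commuting with $\mathbb{R}_m$) with $F_0,F_1:D\to\mathbb{R}_m$, $F_0(\bar z)=F_0(z)$, $F_1(\bar z)=-F_1(z)$. It induces the slice function $f=\mathcal{I}(F):\Omega_D\to\mathbb{R}_m$, $f(\alpha+J\beta)=F_0(\alpha+i\beta)+JF_1(\alpha+i\beta)$. $f$ is slice regular ($f\in\mathcal{SR}(\Omega_D)$) if $F$ is $C^1$ and $\partial_\alpha F_0=\partial_\beta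 F_1$, $\partial_\beta F_0=-\partial_\alpha F_1$ on $D$. The spherical derivative is $f'_s(\alpha+J\beta)=\beta^{-1}F_1(\alpha+i\beta)$ on $\Omega_D\setminus\mathbb{R}$; it depends only on $(\alpha,\beta)$, and $\partial_\beta^j f'_s$ denotes its $j$-th partial derivative in $\beta$ as a function of $(\alpha,\beta)$. $\Delta_{m+1}=\sum_{i=0}^m\partial_{x_i}^2$.
   Formalization: The final polyharmonicity claim is stated only for m ≥ 3; for m = 1 one has γ_m = 0 and the claim would read f'_s = 0, which fails for f(x) = x, where f'_s = 1. Both formulas are stated for all odd m ≥ 1. *)

theory Defs
  imports "HOL-Analysis.Analysis"
begin

section \<open>The real Clifford algebra\<close>

text \<open>The algebra with \<open>m = CARD('m)\<close> generators is modelled on its standard basis of blades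
  \<open>e_A = e_{i_1} \<dots> e_{i_r}\<close>, \<open>A = {i_1 < \<dots> < i_r}\<close>, so it is the real vector space
  of coefficient families indexed by the subsets of \<^typ>\<open>'m\<close>.\<close>

type_synonym 'm clifford = "real ^ ('m set)"

definition blade :: "'m::finite set \<Rightarrow> 'm clifford"
  where "blade A = axis A 1"

text \<open>\<open>e_A e_B = \<plusminus> e_{A \<triangle> B}\<close>: a pair \<open>j < i\<close> with \<open>i \<in> A\<close>, \<open>j \<in> B\<close> contributes \<open>-1\<close> because
  \<open>e_i e_j = - e_j e_i\<close>, and a common index contributes \<open>-1\<close> because \<open>e_i e_i = -1\<close>.\<close>

definition blade_sign :: "'m::{finite,linorder} set \<Rightarrow> 'm set \<Rightarrow> real"
  where "blade_sign A B = (\<Prod>i\<in>A. \<Prod>j\<in>B. if j \<le> i then -1 else 1)"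

definition cmul :: "'m::{finite,linorder} clifford \<Rightarrow> 'm clifford \<Rightarrow> 'm clifford"
    (infixl \<open>\<odot>\<close> 70)
  where "a \<odot> b = (\<Sum>A\<in>UNIV. \<Sum>B\<in>UNIV. (a $ A * b $ B * blade_sign A B) *\<^sub>R blade (sym_diff A B))"

lemma cmul_add_left: "(a + b) \<odot> c = a \<odot> c + b \<odot> c"
  and cmul_add_right: "c \<odot> (a + b) = c \<odot> a + c \<odot> b"
  by (simp_all add: cmul_def algebra_simps sum.distrib)

lemma cmul_scaleR_left: "(r *\<^sub>R a) \<odot> c = r *\<^sub>R (a \<odot> c)"
  and cmul_scaleR_right: "c \<odot> (r *\<^sub>R a) = r *\<^sub>R (c \<odot> a)"
  by (simp_all add: cmul_def scaleR_sum_right mult_ac)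

lemma linear_cmul_left: "linear (\<lambda>a. a \<odot> c)"
  and linear_cmul_right: "linear (\<lambda>a. c \<odot> a)"
  by (simp_all add: linear_iff cmul_add_left cmul_add_right cmul_scaleR_left cmul_scaleR_right)

lemma blade_expansion: "a = (\<Sum>A\<in>UNIV. (a $ A) *\<^sub>R blade A)"
  by (simp add: vec_eq_iff blade_def axis_def if_distrib[of "\<lambda>t. _ * t"] cong: if_cong)

lemma cmul_blade: "blade A \<odot> blade B = blade_sign A B *\<^sub>R blade (sym_diff A B)"
proof -
  have "blade A \<odot> blade B = (\<Sum>A'\<in>UNIV. \<Sum>B'\<in>UNIV. if B' = B then
      if A' = A then blade_sign A B *\<^sub>R blade (sym_diff A B) else 0 else 0)"
    unfolding cmul_def by (intro sum.cong refl) (auto simp: blade_def axis_def)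
  then show ?thesis by simp
qed

lemma prod_sym_diff:
  fixes f :: "'m::finite \<Rightarrow> real"
  assumes "\<And>i. f i * f i = 1"
  shows "prod f (sym_diff A B) = prod f A * prod f B"
proof -
  have "prod f A = prod f (A - B) * prod f (A \<inter> B)" for A B :: "'m set"
    using prod.Int_Diff[of A f B] by (simp add: mult.commute)
  from this[of A B] this[of B A]
  have "prod f A = prod f (A - B) * prod f (A \<inter> B)" "prod f B = prod f (B - A) * prod f (A \<inter> B)"
    by (simp_all add: Int_commute)
  moreover have "prod f (A \<inter> B) * prod f (A \<inter> B) = 1"
    by (simp add: prod.distrib[symmetric] assms)
  moreover have "prod f (sym_diff A B) = prod f (A - B) * prod f (B - A)"
    by (rule prod.union_disjoint) auto
  ultimately show ?thesis by (simp add: algebra_simps)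
qed

lemma blade_sign_sym_diff_left:
  "blade_sign (sym_diff A B) C = blade_sign A C * blade_sign B C"
  unfolding blade_sign_def by (rule prod_sym_diff) (auto simp: prod.distrib[symmetric] intro!: prod.neutral)

lemma blade_sign_sym_diff_right:
  "blade_sign A (sym_diff B C) = blade_sign A B * blade_sign A C"
proof -
  have "(\<Prod>j\<in>sym_diff B C. if j \<le> i then -1 else 1)
      = (\<Prod>j\<in>B. if j \<le> i then -1 else 1) * (\<Prod>j\<in>C. if j \<le> i then -1 else (1::real))" for i :: 'a
    by (rule prod_sym_diff) simp
  then show ?thesis unfolding blade_sign_def by (simp add: prod.distrib)
qed

lemma cmul_assoc_blade: "(blade A \<odot> blade B) \<odot> blade C = blade A \<odot> (blade B \<odot> blade C)"
proof -
  have "sym_diff (sym_diff A B) C = sym_diff A (sym_diff B C)" by blast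
  then show ?thesis
    by (simp add: cmul_blade cmul_scaleR_left cmul_scaleR_right
        blade_sign_sym_diff_left blade_sign_sym_diff_right)
qed

lemma clifford_linear_ext:
  assumes "linear f" "linear g" "\<And>A. f (blade A) = g (blade A)"
  shows "f a = g a"
  by (subst (1 2) blade_expansion[of a])
    (simp add: linear_sum[OF assms(1)] linear_sum[OF assms(2)] linear_cmul[OF assms(1)]
      linear_cmul[OF assms(2)] assms(3))

lemma cmul_assoc: "(a \<odot> b) \<odot> c = a \<odot> (b \<odot> c)"
proof -
  note lin = linear_iff cmul_add_left cmul_add_right cmul_scaleR_left cmul_scaleR_right
  have 1: "(blade A \<odot> blade B) \<odot> c = blade A \<odot> (blade B \<odot> c)" for A B
    by (rule clifford_linear_ext[where a = c]) (simp_all add: lin cmul_assoc_blade)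
  have 2: "(blade A \<odot> b) \<odot> c = blade A \<odot> (b \<odot> c)" for A
    by (rule clifford_linear_ext[where a = b]) (simp_all add: lin 1)
  show ?thesis
    by (rule clifford_linear_ext[where a = a]) (simp_all add: lin 2)
qed

lemma cmul_one_left: "blade {} \<odot> a = a"
  and cmul_one_right: "a \<odot> blade {} = a"
  by (rule clifford_linear_ext[where a = a];
      simp add: linear_iff cmul_add_left cmul_add_right cmul_scaleR_left cmul_scaleR_right
        cmul_blade blade_sign_def)+

lemma clifford_relations:
  "blade {i} \<odot> blade {j} + blade {j} \<odot> blade {i} = (if i = j then -2 else 0) *\<^sub>R blade {}"
proof (cases "i = j")
  case True
  then show ?thesis by (simp add: cmul_blade blade_sign_def scaleR_2[symmetric])
next
  case False
  then have "sym_diff {i} {j} = {i, j}" "sym_diff {j} {i} = {i, j}" by auto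
  with False show ?thesis
    by (auto simp: cmul_blade blade_sign_def)
qed

section \<open>Paravectors\<close>

type_synonym 'm paravector = "real \<times> (real ^ 'm)"

definition paravec :: "'m::finite paravector \<Rightarrow> 'm clifford"
  where "paravec x = fst x *\<^sub>R blade {} + (\<Sum>i\<in>UNIV. (snd x $ i) *\<^sub>R blade {i})"

definition imag_units :: "'m::finite paravector set"  (\<open>\<S>\<close>)
  where "\<S> = {x. fst x = 0 \<and> (\<Sum>i\<in>UNIV. (snd x $ i)\<^sup>2) = 1}"

definition real_axis :: "'m::finite paravector set"
  where "real_axis = {x. snd x = 0}"

text \<open>The coordinates \<open>\<alpha> = x_0\<close> and \<open>\<beta> = sqrt (x_1\<^sup>2 + \<dots> + x_m\<^sup>2)\<close> of a paravector.\<close>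

definition alpha :: "'m::finite paravector \<Rightarrow> real"
  where "alpha x = fst x"

definition beta :: "'m::finite paravector \<Rightarrow> real"
  where "beta x = sqrt (\<Sum>i\<in>UNIV. (snd x $ i)\<^sup>2)"

lemma imag_unit_square:
  assumes "J \<in> \<S>"
  shows "paravec J \<odot> paravec J = - blade {}"
proof -
  define v where "v = snd J"
  have J: "paravec J = (\<Sum>i\<in>UNIV. (v $ i) *\<^sub>R blade {i})" and v: "(\<Sum>i\<in>UNIV. (v $ i)\<^sup>2) = 1"
    using assms by (auto simp: imag_units_def paravec_def v_def)
  define S where "S = (\<Sum>i\<in>UNIV. \<Sum>j\<in>UNIV. (v $ i * v $ j) *\<^sub>R (blade {i} \<odot> blade {j}))"
  have S: "paravec J \<odot> paravec J = S"
  proof -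
    have "paravec J \<odot> paravec J = (\<Sum>i\<in>UNIV. (v $ i) *\<^sub>R (blade {i} \<odot> paravec J))"
      by (subst J) (simp add: linear_sum[OF linear_cmul_left] cmul_scaleR_left)
    also have "\<dots> = S"
      unfolding S_def J
      by (simp add: linear_sum[OF linear_cmul_right] cmul_scaleR_right scaleR_sum_right)
    finally show ?thesis .
  qed
  have S': "S = (\<Sum>i\<in>UNIV. \<Sum>j\<in>UNIV. (v $ i * v $ j) *\<^sub>R (blade {j} \<odot> blade {i}))"
    unfolding S_def by (subst sum.swap) (simp add: mult.commute)
  have "S + S = (\<Sum>i\<in>UNIV. \<Sum>j\<in>UNIV.
      (v $ i * v $ j) *\<^sub>R (blade {i} \<odot> blade {j} + blade {j} \<odot> blade {i}))"
    by (subst (2) S') (simp add: S_def sum.distrib scaleR_add_right)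
  also have "\<dots> = (\<Sum>i\<in>UNIV. (- 2 * (v $ i)\<^sup>2) *\<^sub>R blade {})"
    unfolding clifford_relations scaleR_scaleR
    by (intro sum.cong refl) (simp add: if_distrib[of "\<lambda>t. t *\<^sub>R _"] if_distrib[of "\<lambda>t. _ * t"]
        power2_eq_square mult.commute cong: if_cong)
  also have "\<dots> = (- 2) *\<^sub>R blade {}"
    by (simp only: scaleR_sum_left[symmetric] sum_distrib_left[symmetric] v mult_1_right)
  finally have "2 *\<^sub>R S = 2 *\<^sub>R (- blade {})"
    by (simp only: scaleR_2[symmetric] scaleR_minus_left scaleR_minus_right)
  then show ?thesis using S by (simp only: scaleR_cancel_left) simp
qed

section \<open>Partial derivatives\<close>

definition partial_deriv :: "'a::real_normed_vector \<Rightarrow> ('a \<Rightarrow> 'b::real_normed_vector) \<Rightarrow> 'a \<Rightarrow> 'b"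
  where "partial_deriv v f x = vector_derivative (\<lambda>t. f (x + t *\<^sub>R v)) (at 0)"

definition C1_on :: "'a::euclidean_space set \<Rightarrow> ('a \<Rightarrow> 'b::real_normed_vector) \<Rightarrow> bool"
  where "C1_on U f \<longleftrightarrow> (\<forall>v\<in>Basis.
    (\<forall>x\<in>U. (\<lambda>t. f (x + t *\<^sub>R v)) differentiable (at (0::real))) \<and> continuous_on U (partial_deriv v f))"

definition laplacian :: "('a::euclidean_space \<Rightarrow> 'b::real_normed_vector) \<Rightarrow> 'a \<Rightarrow> 'b"
  where "laplacian f x = (\<Sum>v\<in>Basis. partial_deriv v (partial_deriv v f) x)"

text \<open>Functions of \<open>(\<alpha>, \<beta>)\<close> are functions of \<open>\<alpha> + i \<beta>\<close>.\<close>

abbreviation d_alpha :: "(complex \<Rightarrow> 'b::real_normed_vector) \<Rightarrow> complex \<Rightarrow> 'b"  (\<open>\<partial>\<alpha>\<close>)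
  where "\<partial>\<alpha> \<equiv> partial_deriv 1"

abbreviation d_beta :: "(complex \<Rightarrow> 'b::real_normed_vector) \<Rightarrow> complex \<Rightarrow> 'b"  (\<open>\<partial>\<beta>\<close>)
  where "\<partial>\<beta> \<equiv> partial_deriv \<i>"

section \<open>Slice functions\<close>

definition symmetric_set :: "complex set \<Rightarrow> bool"
  where "symmetric_set D \<longleftrightarrow> (\<forall>z\<in>D. cnj z \<in> D)"

definition circularization :: "complex set \<Rightarrow> 'm::finite paravector set"  (\<open>\<Omega>\<close>)
  where "\<Omega> D = {(\<alpha>, 0) + \<beta> *\<^sub>R J | \<alpha> \<beta> J. Complex \<alpha> \<beta> \<in> D \<and> J \<in> \<S>}"

text \<open>A stem function \<open>F_0 + \<iota> F_1\<close> is given by its two components.\<close>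

definition stem_function ::
    "complex set \<Rightarrow> (complex \<Rightarrow> 'm::finite clifford) \<Rightarrow> (complex \<Rightarrow> 'm clifford) \<Rightarrow> bool"
  where "stem_function D F0 F1 \<longleftrightarrow> (\<forall>z\<in>D. F0 (cnj z) = F0 z \<and> F1 (cnj z) = - F1 z)"

text \<open>\<open>f = \<I>(F_0 + \<iota> F_1)\<close> as functions on \<open>\<Omega> D\<close>; the values of \<open>f\<close> elsewhere are irrelevant.\<close>

definition induced_by :: "complex set \<Rightarrow> (complex \<Rightarrow> 'm::{finite,linorder} clifford) \<Rightarrow>
    (complex \<Rightarrow> 'm clifford) \<Rightarrow> ('m paravector \<Rightarrow> 'm clifford) \<Rightarrow> bool"
  where "induced_by D F0 F1 f \<longleftrightarrow> (\<forall>\<alpha> \<beta>. \<forall>J\<in>\<S>. Complex \<alpha> \<beta> \<in> D \<longrightarrow>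
    f ((\<alpha>, 0) + \<beta> *\<^sub>R J) = F0 (Complex \<alpha> \<beta>) + paravec J \<odot> F1 (Complex \<alpha> \<beta>))"

definition slice_regular ::
    "complex set \<Rightarrow> ('m::{finite,linorder} paravector \<Rightarrow> 'm clifford) \<Rightarrow> bool"
  where "slice_regular D f \<longleftrightarrow> (\<exists>F0 F1. stem_function D F0 F1 \<and> induced_by D F0 F1 f \<and>
    C1_on D F0 \<and> C1_on D F1 \<and>
    (\<forall>z\<in>D. \<partial>\<alpha> F0 z = \<partial>\<beta> F1 z \<and> \<partial>\<beta> F0 z = - \<partial>\<alpha> F1 z))"

text \<open>The component \<open>F_1\<close> of the stem function inducing \<open>f\<close>. It is unique on \<open>D\<close>: see
  \<open>stem1_eq\<close> below.\<close>

definition stem1 :: "complex set \<Rightarrow> ('m::{finite,linorder} paravector \<Rightarrow> 'm clifford) \<Rightarrow>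
    complex \<Rightarrow> 'm clifford"
  where "stem1 D f = (SOME F1. \<exists>F0. stem_function D F0 F1 \<and> induced_by D F0 F1 f)"

text \<open>The spherical derivative \<open>\<beta>\<^sup>-\<^sup>1 F_1(\<alpha> + i \<beta>)\<close>, first as a function of \<open>(\<alpha>, \<beta>)\<close>
  and then as a function of the paravector \<open>x = \<alpha> + J \<beta>\<close>.\<close>

definition sph_deriv_plane :: "complex set \<Rightarrow> ('m::{finite,linorder} paravector \<Rightarrow> 'm clifford) \<Rightarrow>
    complex \<Rightarrow> 'm clifford"
  where "sph_deriv_plane D f z = inverse (Im z) *\<^sub>R stem1 D f z"

definition sph_deriv :: "complex set \<Rightarrow> ('m::{finite,linorder} paravector \<Rightarrow> 'm clifford) \<Rightarrow>
    'm paravector \<Rightarrow> 'm clifford"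
  where "sph_deriv D f x = sph_deriv_plane D f (Complex (alpha x) (beta x))"

lemma induced_by_F1_unique:
  fixes f :: "'m::{finite,linorder} paravector \<Rightarrow> 'm clifford"
  assumes "symmetric_set D" "stem_function D F0 F1" "induced_by D F0 F1 f"
    and "stem_function D G0 G1" "induced_by D G0 G1 f" and z: "z \<in> D"
  shows "F1 z = G1 z"
proof -
  define J :: "'m paravector" where "J = (0, axis undefined 1)"
  have "(axis undefined 1 $ i)\<^sup>2 = (if i = undefined then 1 else (0::real))" for i :: 'm
    by (simp add: axis_def)
  then have J: "J \<in> \<S>" by (simp add: imag_units_def J_def)
  obtain a b where ab: "z = Complex a b" by (cases z)
  have z': "Complex a (- b) = cnj z" by (simp add: ab complex_eq_iff)
  have cz: "cnj z \<in> D" using assms(1) z by (auto simp: symmetric_set_def)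
  have f1: "f ((a, 0) + b *\<^sub>R J) = H0 z + paravec J \<odot> H1 z"
    and f2: "f ((a, 0) + (- b) *\<^sub>R J) = H0 z - paravec J \<odot> H1 z"
    if "stem_function D H0 H1" "induced_by D H0 H1 f" for H0 H1
  proof -
    show "f ((a, 0) + b *\<^sub>R J) = H0 z + paravec J \<odot> H1 z"
      using that(2) J z unfolding induced_by_def ab by blast
    have "f ((a, 0) + (- b) *\<^sub>R J) = H0 (cnj z) + paravec J \<odot> H1 (cnj z)"
      using that(2) J cz unfolding induced_by_def z'[symmetric] by blast
    then show "f ((a, 0) + (- b) *\<^sub>R J) = H0 z - paravec J \<odot> H1 z"
      using that(1) z cmul_scaleR_right[of "paravec J" "-1" "H1 z"]
      by (simp add: stem_function_def)
  qed
  have "F0 z + p = G0 z + q \<Longrightarrow> F0 z - p = G0 z - q \<Longrightarrow> 2 *\<^sub>R p = 2 *\<^sub>R q" for p q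
    by (simp add: vec_eq_iff) (smt (verit))
  then have "2 *\<^sub>R (paravec J \<odot> F1 z) = 2 *\<^sub>R (paravec J \<odot> G1 z)"
    using f1[OF assms(2,3)] f2[OF assms(2,3)] f1[OF assms(4,5)] f2[OF assms(4,5)] by metis
  then have "paravec J \<odot> (paravec J \<odot> F1 z) = paravec J \<odot> (paravec J \<odot> G1 z)" by simp
  then have "(- blade {}) \<odot> F1 z = (- blade {}) \<odot> G1 z"
    by (simp only: cmul_assoc[symmetric] imag_unit_square[OF J])
  moreover have "(- blade {}) \<odot> c = - c" for c :: "'m clifford"
    using cmul_scaleR_left[of "-1" "blade {}" c] by (simp add: cmul_one_left)
  ultimately show ?thesis by simp
qed

lemma stem1_eq:
  assumes "symmetric_set D" "stem_function D F0 F1" "induced_by D F0 F1 f" "z \<in> D"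
  shows "stem1 D f z = F1 z"
proof -
  have "\<exists>F0. stem_function D F0 (stem1 D f) \<and> induced_by D F0 (stem1 D f) f"
    unfolding stem1_def by (rule someI[where x = F1]) (use assms in blast)
  then show ?thesis using induced_by_F1_unique[OF assms(1)] assms by blast
qed

lemma sph_deriv_eq:
  assumes "symmetric_set D" "stem_function D F0 F1" "induced_by D F0 F1 f"
    and "Complex (alpha x) (beta x) \<in> D"
  shows "sph_deriv D f x = inverse (beta x) *\<^sub>R F1 (Complex (alpha x) (beta x))"
  using stem1_eq[OF assms] by (simp add: sph_deriv_def sph_deriv_plane_def)

section \<open>The coefficients\<close>

definition a_coeff :: "nat \<Rightarrow> nat \<Rightarrow> real"
  where "a_coeff k j = fact (2 * k - j - 1) / (fact (j - 1) * fact (k - j) * (-2) ^ (k - j))"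

end

theory Submission
  imports Defs "HOL-Complex_Analysis.Cauchy_Integral_Formula"
begin

text \<open>The sums in the statement are \<open>V\<^sub>k = (\<beta>\<^sup>-\<^sup>1 \<partial>\<beta>)\<^sup>k (\<beta>\<^sup>-\<^sup>1 F\<^sub>1)\<close>, written out in terms of
  \<open>\<partial>\<beta>\<^sup>j f'\<^sub>s\<close> or of \<open>\<partial>\<beta>\<^sup>j F\<^sub>1\<close>: the coefficients satisfy exactly the recursion that makes
  \<open>\<beta>\<^sup>-\<^sup>1 \<partial>\<beta>\<close> raise \<open>k\<close> by one. As \<open>F\<^sub>1\<close> is componentwise the imaginary part of a holomorphic
  function, it is smooth and harmonic, and from this
  \<open>\<partial>\<alpha>\<^sup>2 V\<^sub>k = - (2 k + 3) V\<^sub>k\<^sub>+\<^sub>1 - \<beta>\<^sup>2 V\<^sub>k\<^sub>+\<^sub>2\<close> follows by induction, applying \<open>\<beta>\<^sup>-\<^sup>1 \<partial>\<beta>\<close> to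
  both sides. On the other hand \<open>\<partial>\<close> in the direction \<open>x\<^sub>i\<close> maps \<open>V\<^sub>k\<close> to \<open>x\<^sub>i V\<^sub>k\<^sub>+\<^sub>1\<close>, so the second
  derivatives in these \<open>m\<close> directions add up to \<open>m V\<^sub>k\<^sub>+\<^sub>1 + \<beta>\<^sup>2 V\<^sub>k\<^sub>+\<^sub>2\<close>. Altogether
  \<open>\<Delta> V\<^sub>k = (m - 2 k - 3) V\<^sub>k\<^sub>+\<^sub>1\<close>.\<close>

section \<open>Directional derivatives\<close>

text \<open>\<open>partial_deriv\<close> is total and says nothing about existence. The relational
  form carries existence along, so the derivative rules compose and the value is read off at the
  end.\<close>

definition has_partial_deriv ::
    "'a::real_normed_vector \<Rightarrow> ('a \<Rightarrow> 'b::real_normed_vector) \<Rightarrow> 'b \<Rightarrow> 'a \<Rightarrow> bool"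
  where "has_partial_deriv v f d x \<longleftrightarrow> ((\<lambda>t. f (x + t *\<^sub>R v)) has_vector_derivative d) (at (0::real))"

lemma partial_deriv_eqI: "has_partial_deriv v f d x \<Longrightarrow> partial_deriv v f x = d"
  unfolding has_partial_deriv_def partial_deriv_def by (rule vector_derivative_at)

lemma has_partial_deriv_unique:
  "has_partial_deriv v f d x \<Longrightarrow> has_partial_deriv v f d' x \<Longrightarrow> d = d'"
  by (auto dest!: partial_deriv_eqI)

lemma eventually_line:
  fixes x v :: "'a::real_normed_vector"
  assumes "open S" "x \<in> S"
  shows "\<forall>\<^sub>F t in nhds (0::real). x + t *\<^sub>R v \<in> S"
proof -
  have "isCont (\<lambda>t::real. x + t *\<^sub>R v) 0" by (intro continuous_intros)
  then have "((\<lambda>t. x + t *\<^sub>R v) \<longlongrightarrow> x) (nhds (0::real))"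
    by (simp add: continuous_at tendsto_nhds_iff)
  then show ?thesis using assms by (rule topological_tendstoD)
qed

lemma has_partial_deriv_cong:
  assumes "open S" "x \<in> S" "\<And>y. y \<in> S \<Longrightarrow> f y = g y"
  shows "has_partial_deriv v f d x \<longleftrightarrow> has_partial_deriv v g d x"
  unfolding has_partial_deriv_def using assms(3)[OF assms(2)]
  by (intro has_vector_derivative_cong_ev refl eventually_mono[OF eventually_line[OF assms(1,2)]])
    (auto intro: assms(3))

text \<open>Holds even where no derivative exists: both sides are the same choice from equivalent
  predicates.\<close>

lemma partial_deriv_cong:
  assumes "open S" "x \<in> S" "\<And>y. y \<in> S \<Longrightarrow> f y = g y"
  shows "partial_deriv v f x = partial_deriv v g x"
  using has_partial_deriv_cong[where f = f and g = g, OF assms(1,2)] assms(3)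
  unfolding partial_deriv_def vector_derivative_def has_partial_deriv_def by presburger

lemma laplacian_cong:
  assumes "open S" "x \<in> S" "\<And>y. y \<in> S \<Longrightarrow> f y = g y"
  shows "laplacian f x = laplacian g x"
  unfolding laplacian_def
  by (intro sum.cong refl partial_deriv_cong[OF assms(1,2)] partial_deriv_cong[OF assms(1)] assms(3))

text \<open>The outer derivative sees the inner one at points near \<open>z\<close>, so the
  induction needs equality on all of the open set \<open>S\<close>.\<close>

lemma funpow_partial_deriv_eq:
  assumes "open S" and "\<And>z. z \<in> S \<Longrightarrow> f z = U 0 z"
    and "\<And>j z. z \<in> S \<Longrightarrow> has_partial_deriv v (U j) (U (Suc j) z) z" and "z \<in> S"
  shows "(partial_deriv v ^^ j) f z = U j z"
  using assms(4)
proof (induction j arbitrary: z)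
  case (Suc j)
  have "partial_deriv v ((partial_deriv v ^^ j) f) z = partial_deriv v (U j) z"
    by (rule partial_deriv_cong[OF assms(1)]) (use Suc in auto)
  with assms(3)[OF Suc.prems, of j] show ?case by (simp add: partial_deriv_eqI)
qed (simp add: assms(2))

lemma has_partial_deriv_scaleR:
  assumes "has_partial_deriv v c c' x" "has_partial_deriv v f f' x"
  shows "has_partial_deriv v (\<lambda>x. c x *\<^sub>R f x) (c x *\<^sub>R f' + c' *\<^sub>R f x) x"
  using has_vector_derivative_scaleR[OF assms[unfolded has_partial_deriv_def
        has_real_derivative_iff_has_vector_derivative[symmetric]]]
  by (simp add: has_partial_deriv_def)

lemma has_partial_deriv_sum:
  assumes "\<And>j. j \<in> I \<Longrightarrow> has_partial_deriv v (f j) (f' j) x"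
  shows "has_partial_deriv v (\<lambda>x. \<Sum>j\<in>I. f j x) (\<Sum>j\<in>I. f' j) x"
  using assms unfolding has_partial_deriv_def by (intro has_vector_derivative_sum)

lemma has_partial_deriv_add:
  assumes "has_partial_deriv v f f' x" "has_partial_deriv v g g' x"
  shows "has_partial_deriv v (\<lambda>x. f x + g x) (f' + g') x"
  using assms unfolding has_partial_deriv_def by (rule has_vector_derivative_add)

lemma has_partial_deriv_diff:
  assumes "has_partial_deriv v f f' x" "has_partial_deriv v g g' x"
  shows "has_partial_deriv v (\<lambda>x. f x - g x) (f' - g') x"
  using assms unfolding has_partial_deriv_def by (rule has_vector_derivative_diff)

lemma has_partial_deriv_const: "has_partial_deriv v (\<lambda>_. c) 0 x"
  by (simp add: has_partial_deriv_def)

lemma has_partial_deriv_scaleR_const: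
  "has_partial_deriv v f f' x \<Longrightarrow> has_partial_deriv v (\<lambda>x. c *\<^sub>R f x) (c *\<^sub>R f') x"
  using has_partial_deriv_scaleR[OF has_partial_deriv_const, of v f f' x c] by simp

lemma has_partial_deriv_Im_1: "has_partial_deriv 1 Im 0 z"
  by (simp add: has_partial_deriv_def)

lemma has_partial_deriv_Im_ii: "has_partial_deriv \<i> Im 1 z"
  unfolding has_partial_deriv_def
  by (auto intro!: derivative_eq_intros simp: has_real_derivative_iff_has_vector_derivative[symmetric])

lemma has_partial_deriv_Im_power_int:
  assumes "has_partial_deriv v Im d z" "Im z \<noteq> 0"
  shows "has_partial_deriv v (\<lambda>z. Im z powi n) (of_int n * Im z powi (n - 1) * d) z"
  using DERIV_power_int[OF assms(1)[unfolded has_partial_deriv_def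
        has_real_derivative_iff_has_vector_derivative[symmetric]], of n] assms(2)
  by (simp add: has_partial_deriv_def has_real_derivative_iff_has_vector_derivative[symmetric])

section \<open>Powers of the radial operator\<close>

text \<open>If \<open>U (Suc j)\<close> is the beta-derivative of \<open>U j\<close> for j >= 1,
  this is beta^-1 \<open>U 1\<close> with the operator beta^-1 d_beta applied k - 1 times, for k >=
  1.\<close>

definition radial_sum :: "(nat \<Rightarrow> complex \<Rightarrow> 'b::real_vector) \<Rightarrow> nat \<Rightarrow> complex \<Rightarrow> 'b"
  where "radial_sum U k z = (\<Sum>j=1..k. (a_coeff k j * Im z powi (int j - 2 * int k)) *\<^sub>R U j z)"

lemma a_coeff_self: "k \<ge> 1 \<Longrightarrow> a_coeff k k = 1"
  by (simp add: a_coeff_def mult_2)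

text \<open>Separate from \<open>a_coeff_Suc\<close>: truncated subtraction makes
  \<open>a_coeff k 0\<close> nonzero, so the general recursion fails at j = 1.\<close>

lemma a_coeff_Suc_1:
  assumes "k \<ge> 1"
  shows "a_coeff (Suc k) 1 = (1 - 2 * real k) * a_coeff k 1"
proof -
  obtain l where k: "k = Suc l" using assms by (cases k) auto
  have e: "2 * Suc (Suc l) - 1 - 1 = Suc (Suc (2 * l))" "2 * Suc l - 1 - 1 = 2 * l" by auto
  show ?thesis unfolding a_coeff_def k e
    by (simp add: divide_simps del: of_nat_Suc) (simp add: algebra_simps)
qed

text \<open>The first term comes from differentiating beta^(j-2k), the second from differentiating
  \<open>U (j - 1)\<close>. Writing j = i + 2 and k = j + l removes every truncated
  subtraction.\<close>

lemma a_coeff_Suc: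
  assumes "2 \<le> j" "j \<le> k"
  shows "a_coeff (Suc k) j = (real j - 2 * real k) * a_coeff k j + a_coeff k (j - 1)"
proof -
  obtain i where j: "j = Suc (Suc i)" using assms(1) by (metis add_2_eq_Suc le_Suc_ex)
  obtain l where k: "k = j + l" using assms(2) by (auto simp: le_iff_add)
  have e: "2 * Suc k - j - 1 = Suc (Suc (Suc (i + 2 * l)))" "Suc k - j = Suc l"
     "2 * k - j - 1 = Suc (i + 2 * l)" "k - j = l"
     "2 * k - (j - 1) - 1 = Suc (Suc (i + 2 * l))" "k - (j - 1) = Suc l"
    by (auto simp: j k)
  show ?thesis unfolding a_coeff_def e
    by (simp add: j k divide_simps) (simp add: algebra_simps)
qed

lemma radial_sum_1: "radial_sum U (Suc 0) z = inverse (Im z) *\<^sub>R U 1 z"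
  by (simp add: radial_sum_def a_coeff_def power_int_minus)

lemma has_partial_deriv_radial_sum_1:
  assumes "Im z \<noteq> 0" "\<And>j. j \<ge> 1 \<Longrightarrow> has_partial_deriv 1 (U j) (U' j z) z"
  shows "has_partial_deriv 1 (radial_sum U k) (radial_sum U' k z) z"
proof -
  have "has_partial_deriv 1 (\<lambda>z. (Im z powi n) *\<^sub>R U j z) ((Im z powi n) *\<^sub>R U' j z) z"
    if "j \<ge> 1" for n j
    using has_partial_deriv_scaleR[OF has_partial_deriv_Im_power_int[OF has_partial_deriv_Im_1 assms(1)]
        assms(2)[OF that], of n] by simp
  then show ?thesis unfolding radial_sum_def scaleR_scaleR[symmetric]
    by (intro has_partial_deriv_sum has_partial_deriv_scaleR_const) auto
qed

lemma has_partial_deriv_radial_sum_ii: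
  assumes z: "Im z \<noteq> 0" and k: "k \<ge> 1"
    and U: "\<And>j. j \<ge> 1 \<Longrightarrow> has_partial_deriv \<i> (U j) (U (Suc j) z) z"
  shows "has_partial_deriv \<i> (radial_sum U k) (Im z *\<^sub>R radial_sum U (Suc k) z) z"
proof -
  \<comment> \<open>The product rule splits into \<open>s\<close>, where the power is
    differentiated, and \<open>t\<close>, where \<open>U\<close> is differentiated and the index
    moves up by one. \<open>r\<close> is the target term; its exponent exceeds that of
    \<open>radial_sum U (Suc k)\<close> by one, which leaves the factor \<open>Im z\<close>.\<close>
  define p where "p j = Im z powi (int j - 2 * int k - 1)" for j
  define r where "r j = (a_coeff (Suc k) j * p j) *\<^sub>R U j z" for j
  define s where "s j = ((real j - 2 * real k) * a_coeff k j * p j) *\<^sub>R U j z" for j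
  define t where "t j = (a_coeff k (j - 1) * p j) *\<^sub>R U j z" for j
  have "has_partial_deriv \<i> (\<lambda>z. (Im z powi (int j - 2 * int k)) *\<^sub>R U j z)
      ((Im z powi (int j - 2 * int k)) *\<^sub>R U (Suc j) z
        + ((real j - 2 * real k) * p j) *\<^sub>R U j z) z" if "j \<ge> 1" for j
    using has_partial_deriv_scaleR[OF has_partial_deriv_Im_power_int[OF has_partial_deriv_Im_ii z]
        U[OF that], of "int j - 2 * int k"] by (simp add: p_def)
  then have "has_partial_deriv \<i> (radial_sum U k) (\<Sum>j=1..k. a_coeff k j *\<^sub>R
      ((Im z powi (int j - 2 * int k)) *\<^sub>R U (Suc j) z
        + ((real j - 2 * real k) * p j) *\<^sub>R U j z)) z"
    unfolding radial_sum_def scaleR_scaleR[symmetric]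
    by (intro has_partial_deriv_sum has_partial_deriv_scaleR_const) auto
  moreover have "(\<Sum>j=1..k. a_coeff k j *\<^sub>R
      ((Im z powi (int j - 2 * int k)) *\<^sub>R U (Suc j) z
        + ((real j - 2 * real k) * p j) *\<^sub>R U j z)) = (\<Sum>j=1..k. t (Suc j)) + (\<Sum>j=1..k. s j)"
    unfolding sum.distrib[symmetric]
    by (intro sum.cong refl) (simp add: s_def t_def p_def scaleR_add_right mult_ac)
  moreover have "(\<Sum>j=1..k. t (Suc j)) = (\<Sum>j=2..k. t j) + t (Suc k)"
    using k by (simp add: sum.shift_bounds_cl_Suc_ivl[symmetric] numeral_2_eq_2)
  moreover have "(\<Sum>j=1..k. s j) = s 1 + (\<Sum>j=2..k. s j)"
    using k by (simp add: sum.atLeast_Suc_atMost numeral_2_eq_2)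
  moreover have "s 1 = r 1"
    using a_coeff_Suc_1[OF k] by (simp add: s_def r_def)
  moreover have "t (Suc k) = r (Suc k)"
    using k by (simp add: t_def r_def a_coeff_self)
  moreover have "(\<Sum>j=2..k. t j) + (\<Sum>j=2..k. s j) = (\<Sum>j=2..k. r j)"
    unfolding sum.distrib[symmetric]
    by (intro sum.cong refl) (simp add: s_def t_def r_def a_coeff_Suc algebra_simps)
  moreover have "r 1 + (\<Sum>j=2..k. r j) + r (Suc k) = (\<Sum>j=1..Suc k. r j)"
    using k by (simp add: sum.atLeast_Suc_atMost numeral_2_eq_2)
  moreover have "(\<Sum>j=1..Suc k. r j) = Im z *\<^sub>R radial_sum U (Suc k) z"
    unfolding radial_sum_def scaleR_sum_right
  proof (intro sum.cong refl)
    fix j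
    have "p j = Im z * Im z powi (int j - 2 * int (Suc k))"
      using z power_int_add_1[of "Im z" "int j - 2 * int (Suc k)"]
      by (simp add: p_def mult.commute algebra_simps)
    then show "r j = Im z *\<^sub>R (a_coeff (Suc k) j * Im z powi (int j - 2 * int (Suc k))) *\<^sub>R U j z"
      by (simp add: r_def mult_ac)
  qed
  ultimately show ?thesis by (simp add: algebra_simps)
qed

section \<open>The Laplacian of functions of alpha and beta\<close>

definition slice_point :: "'m::finite paravector \<Rightarrow> complex"
  where "slice_point x = Complex (alpha x) (beta x)"

lemma beta_eq_norm: "beta x = norm (snd x)"
  by (simp add: beta_def norm_vec_def L2_set_def)

lemma slice_point_sel [simp]: "Re (slice_point x) = alpha x" "Im (slice_point x) = beta x"
  by (simp_all add: slice_point_def)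

lemma open_slice_point_vimage:
  assumes "open U"
  shows "open (slice_point -` U :: 'm::finite paravector set)"
proof -
  have "slice_point = (\<lambda>x::'m paravector. of_real (fst x) + of_real (norm (snd x)) * \<i>)"
    by (auto simp: fun_eq_iff complex_eq_iff alpha_def beta_eq_norm)
  moreover have "continuous_on UNIV (\<lambda>x::'m paravector.
      complex_of_real (fst x) + complex_of_real (norm (snd x)) * \<i>)"
    by (intro continuous_intros)
  ultimately have "continuous_on UNIV (slice_point :: 'm paravector \<Rightarrow> complex)" by (simp only:)
  then show ?thesis by (rule open_vimage[OF assms])
qed

lemma has_partial_deriv_slice_point_alpha:
  assumes "has_partial_deriv 1 w d (slice_point x)"
  shows "has_partial_deriv (1, 0) (\<lambda>x. w (slice_point x)) d x"
proof -
  have "slice_point (x + t *\<^sub>R (1, 0)) = slice_point x + t *\<^sub>R 1" for t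
    by (simp add: complex_eq_iff alpha_def beta_def)
  then show ?thesis using assms by (simp add: has_partial_deriv_def)
qed

text \<open>Chain rule with x_i / beta as the x_i-derivative of beta. Writing the beta-derivative of
  \<open>w\<close> as beta times \<open>d\<close> cancels the denominator.\<close>

lemma has_partial_deriv_slice_point_axis:
  fixes x :: "'m::finite paravector"
  assumes "has_partial_deriv \<i> w (beta x *\<^sub>R d) (slice_point x)" and "beta x > 0"
  shows "has_partial_deriv (0, axis i 1) (\<lambda>x. w (slice_point x)) ((snd x $ i) *\<^sub>R d) x"
proof -
  define y where "y = snd x"
  \<comment> \<open>The increment of beta along the line vanishes at parameter 0, which is where the
    directional derivative of \<open>w\<close> is taken.\<close>
  define \<phi> where "\<phi> t = norm (y + t *\<^sub>R axis i 1) - norm y" for t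
  have y: "norm y > 0" using assms(2) by (simp add: beta_eq_norm y_def)
  have "((\<lambda>t. y + t *\<^sub>R axis i 1) has_derivative (\<lambda>t. t *\<^sub>R axis i 1)) (at (0::real))"
    by (auto intro!: derivative_eq_intros)
  moreover have "(norm has_derivative (\<lambda>v. v \<bullet> sgn y)) (at (y + 0 *\<^sub>R axis i 1))"
    using has_derivative_norm[of y] y by simp
  ultimately have "((\<lambda>t. norm (y + t *\<^sub>R axis i 1)) has_derivative
      (\<lambda>t. (t *\<^sub>R axis i 1) \<bullet> sgn y)) (at 0)"
    by (rule has_derivative_compose)
  moreover have "(t *\<^sub>R axis i 1) \<bullet> sgn y = t *\<^sub>R (y $ i / norm y)" for t
    by (simp add: inner_axis' sgn_div_norm divide_inverse)
  ultimately have \<phi>: "(\<phi> has_vector_derivative (y $ i / norm y)) (at 0)"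
    unfolding \<phi>_def has_vector_derivative_def
    by (auto intro!: derivative_eq_intros)
  have "((\<lambda>t. w (slice_point x + t *\<^sub>R \<i>)) has_vector_derivative (beta x *\<^sub>R d)) (at (\<phi> 0))"
    using assms(1) by (simp add: has_partial_deriv_def \<phi>_def)
  from vector_diff_chain_at[OF \<phi> this]
  have "((\<lambda>t. w (slice_point x + \<phi> t *\<^sub>R \<i>)) has_vector_derivative ((snd x $ i) *\<^sub>R d)) (at 0)"
    using y by (simp add: o_def beta_eq_norm y_def)
  moreover have "slice_point (x + t *\<^sub>R (0, axis i 1)) = slice_point x + \<phi> t *\<^sub>R \<i>" for t
    by (simp add: complex_eq_iff alpha_def beta_eq_norm \<phi>_def y_def)
  ultimately show ?thesis by (simp add: has_partial_deriv_def)
qed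

lemma sum_Basis_paravector:
  fixes F :: "'m::finite paravector \<Rightarrow> 'b::comm_monoid_add"
  shows "(\<Sum>v\<in>Basis. F v) = F (1, 0) + (\<Sum>i\<in>UNIV. F (0, axis i 1))"
proof -
  let ?e = "\<lambda>i::'m. (0::real, axis i (1::real))"
  have B: "(Basis :: 'm paravector set) = insert (1, 0) (range ?e)"
    by (auto simp: Basis_prod_def Basis_vec_def)
  have "(1, 0) \<notin> range ?e" by auto
  then have "(\<Sum>v\<in>Basis. F v) = F (1, 0) + (\<Sum>v\<in>range ?e. F v)"
    unfolding B by (intro sum.insert) auto
  moreover have "inj ?e" by (simp add: inj_on_def axis_eq_axis)
  then have "(\<Sum>v\<in>range ?e. F v) = (\<Sum>i\<in>UNIV. F (?e i))"
    by (simp add: sum.reindex)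
  ultimately show ?thesis by simp
qed

text \<open>\<open>w1\<close> and \<open>w2\<close> stand for one and two applications of beta^-1
  d_beta to \<open>w\<close>. The direction x_i contributes \<open>w1\<close> + x_i^2
  \<open>w2\<close>, and the x_i^2 add up to beta^2.\<close>

lemma laplacian_slice_point:
  fixes x :: "'m::finite paravector"
  assumes "open U" and x: "slice_point x \<in> U"
    and U: "\<And>z. z \<in> U \<Longrightarrow> Im z > 0"
    and w: "\<And>z. z \<in> U \<Longrightarrow> has_partial_deriv \<i> w (Im z *\<^sub>R w1 z) z"
    and w1: "\<And>z. z \<in> U \<Longrightarrow> has_partial_deriv \<i> w1 (Im z *\<^sub>R w2 z) z"
    and p: "\<And>z. z \<in> U \<Longrightarrow> has_partial_deriv 1 w (p z) z"
    and q: "\<And>z. z \<in> U \<Longrightarrow> has_partial_deriv 1 p (q z) z"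
  shows "laplacian (\<lambda>x. w (slice_point x)) x =
    real CARD('m) *\<^sub>R w1 (slice_point x) + (beta x)\<^sup>2 *\<^sub>R w2 (slice_point x) + q (slice_point x)"
proof -
  let ?S = "slice_point -` U :: 'm paravector set"
  note S = open_slice_point_vimage[OF assms(1)]
  have beta: "y \<in> ?S \<Longrightarrow> beta y > 0" for y using U[of "slice_point y"] by simp
  have "partial_deriv (1, 0) (\<lambda>x. w (slice_point x)) y = p (slice_point y)" if "y \<in> ?S" for y
    using that by (intro partial_deriv_eqI has_partial_deriv_slice_point_alpha p) auto
  then have "partial_deriv (1, 0) (partial_deriv (1, 0) (\<lambda>x. w (slice_point x))) x
      = partial_deriv (1, 0) (\<lambda>x. p (slice_point x)) x"
    using x by (intro partial_deriv_cong[OF S]) auto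
  also have "\<dots> = q (slice_point x)"
    by (intro partial_deriv_eqI has_partial_deriv_slice_point_alpha q x)
  finally have first: "partial_deriv (1, 0) (partial_deriv (1, 0) (\<lambda>x. w (slice_point x))) x
      = q (slice_point x)" .
  have other: "partial_deriv (0, axis i 1) (partial_deriv (0, axis i 1) (\<lambda>x. w (slice_point x))) x
      = w1 (slice_point x) + (snd x $ i)\<^sup>2 *\<^sub>R w2 (slice_point x)" for i
  proof -
    have "partial_deriv (0, axis i 1) (\<lambda>x. w (slice_point x)) y
        = (snd y $ i) *\<^sub>R w1 (slice_point y)" if "y \<in> ?S" for y
      using that w[of "slice_point y"] beta[OF that]
      by (intro partial_deriv_eqI has_partial_deriv_slice_point_axis) auto
    then have "partial_deriv (0, axis i 1) (partial_deriv (0, axis i 1) (\<lambda>x. w (slice_point x))) x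
        = partial_deriv (0, axis i 1) (\<lambda>y. (snd y $ i) *\<^sub>R w1 (slice_point y)) x"
      using x by (intro partial_deriv_cong[OF S]) auto
    also have "\<dots> = (snd x $ i) *\<^sub>R ((snd x $ i) *\<^sub>R w2 (slice_point x)) + 1 *\<^sub>R w1 (slice_point x)"
    proof (intro partial_deriv_eqI has_partial_deriv_scaleR has_partial_deriv_slice_point_axis)
      show "has_partial_deriv (0, axis i 1) (\<lambda>y::'m paravector. snd y $ i) 1 x"
        unfolding has_partial_deriv_def has_real_derivative_iff_has_vector_derivative[symmetric]
        by (auto intro!: derivative_eq_intros)
      show "has_partial_deriv \<i> w1 (beta x *\<^sub>R w2 (slice_point x)) (slice_point x)"
        using w1[OF x] by simp
      show "beta x > 0" using x beta by simp
    qed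
    finally show ?thesis by (simp add: power2_eq_square)
  qed
  have "(beta x)\<^sup>2 = (\<Sum>i\<in>UNIV. (snd x $ i)\<^sup>2)"
    by (simp add: beta_def sum_nonneg)
  then show ?thesis
    unfolding laplacian_def sum_Basis_paravector first other
    by (simp add: sum.distrib scaleR_sum_left[symmetric] sum_constant_scaleR)
qed

section \<open>Iterated Laplacians\<close>

text \<open>On \<open>U\<close> the functions \<open>H j\<close> and \<open>K j\<close> play the roles of \<open>\<partial>\<beta>\<^sup>j F\<^sub>1\<close> and
  \<open>\<partial>\<alpha> \<partial>\<beta>\<^sup>j F\<^sub>1\<close>; the last assumption says that \<open>\<partial>\<beta>\<^sup>j F\<^sub>1\<close> is harmonic.\<close>

locale harmonic_jet =
  fixes U :: "complex set" and H K :: "nat \<Rightarrow> complex \<Rightarrow> 'b::real_normed_vector"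
  assumes U_open: "open U" and U_pos: "z \<in> U \<Longrightarrow> Im z > 0"
    and H_beta: "z \<in> U \<Longrightarrow> has_partial_deriv \<i> (H j) (H (Suc j) z) z"
    and H_alpha: "z \<in> U \<Longrightarrow> has_partial_deriv 1 (H j) (K j z) z"
    and K_alpha: "z \<in> U \<Longrightarrow> has_partial_deriv 1 (K j) (- H (Suc (Suc j)) z) z"
begin

text \<open>\<open>radial_sum\<close> starts at index 1, so the shift to \<open>j - 1\<close> makes
  \<open>V 0\<close> equal to beta^-1 \<open>H 0\<close> and \<open>V k\<close> the sum in the
  second formula.\<close>

definition V :: "nat \<Rightarrow> complex \<Rightarrow> 'b"
  where "V k = radial_sum (\<lambda>j. H (j - 1)) (Suc k)"

text \<open>\<open>T k\<close> is \<open>(\<beta>\<^sup>-\<^sup>1 \<partial>\<beta>)\<^sup>k \<partial>\<beta> F\<^sub>1\<close> and equals \<open>- \<partial>\<alpha>\<^sup>2 V (k - 1)\<close>, see \<open>V_alpha_alpha\<close>.\<close>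

definition T :: "nat \<Rightarrow> complex \<Rightarrow> 'b"
  where "T k = radial_sum (\<lambda>j. H (Suc j)) k"

lemma V_0: "V 0 z = inverse (Im z) *\<^sub>R H 0 z"
  by (simp add: V_def radial_sum_1)

lemma V_beta:
  assumes "z \<in> U"
  shows "has_partial_deriv \<i> (V k) (Im z *\<^sub>R V (Suc k) z) z"
  unfolding V_def
proof (rule has_partial_deriv_radial_sum_ii)
  fix j :: nat assume "j \<ge> 1"
  then show "has_partial_deriv \<i> (H (j - 1)) (H (Suc j - 1) z) z"
    using H_beta[OF assms, of "j - 1"] by simp
qed (use U_pos[OF assms] in auto)

lemma T_beta:
  assumes "z \<in> U" "k \<ge> 1"
  shows "has_partial_deriv \<i> (T k) (Im z *\<^sub>R T (Suc k) z) z"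
  unfolding T_def using U_pos[OF assms(1)] assms
  by (intro has_partial_deriv_radial_sum_ii H_beta) auto

lemma V_alpha:
  assumes "z \<in> U"
  shows "has_partial_deriv 1 (V k) (radial_sum (\<lambda>j. K (j - 1)) (Suc k) z) z"
  unfolding V_def using U_pos[OF assms]
  by (intro has_partial_deriv_radial_sum_1 H_alpha assms) auto

text \<open>The coefficients do not depend on alpha, so harmonicity applies termwise and replaces
  \<open>H (j - 1)\<close> by minus \<open>H (Suc j)\<close>.\<close>

lemma V_alpha_alpha:
  assumes "z \<in> U"
  shows "has_partial_deriv 1 (radial_sum (\<lambda>j. K (j - 1)) (Suc k)) (- T (Suc k) z) z"
proof -
  have "has_partial_deriv 1 (radial_sum (\<lambda>j. K (j - 1)) (Suc k))
      (radial_sum (\<lambda>j z. - H (Suc j) z) (Suc k) z) z"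
  proof (rule has_partial_deriv_radial_sum_1)
    fix j :: nat assume "j \<ge> 1"
    then show "has_partial_deriv 1 (K (j - 1)) (- H (Suc j) z) z"
      using K_alpha[OF assms, of "j - 1"] by simp
  qed (use U_pos[OF assms] in auto)
  then show ?thesis by (simp add: T_def radial_sum_def sum_negf)
qed

text \<open>Explicit coefficients enter only at k = 0. Applying beta^-1 d_beta to both sides raises
  every index by one, and differentiating beta^2 adds 2 \<open>V (Suc (Suc k))\<close>, which turns
  2k + 3 into 2(k + 1) + 3.\<close>

lemma T_eq:
  assumes "z \<in> U"
  shows "T (Suc k) z = (2 * real k + 3) *\<^sub>R V (Suc k) z + (Im z)\<^sup>2 *\<^sub>R V (Suc (Suc k)) z"
  using assms
proof (induction k arbitrary: z)
  case 0
  have "Im z \<noteq> 0" using U_pos[OF 0] by simp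
  moreover have "{Suc 0..3} = {1, 2, 3::nat}" "{Suc 0..2} = {1, 2::nat}" by auto
  ultimately show ?case
    by (simp add: T_def V_def radial_sum_def a_coeff_def eval_nat_numeral fact_reduce
        power_int_minus algebra_simps power_int_def divide_simps)
next
  case (Suc k)
  let ?c = "2 * real k + 3"
  have z: "Im z \<noteq> 0" using U_pos[OF Suc.prems] by simp
  have sq: "has_partial_deriv \<i> (\<lambda>z. (Im z)\<^sup>2) (2 * Im z) z"
    using has_partial_deriv_Im_power_int[OF has_partial_deriv_Im_ii z, of 2] by simp
  have "has_partial_deriv \<i> (\<lambda>z. ?c *\<^sub>R V (Suc k) z + (Im z)\<^sup>2 *\<^sub>R V (Suc (Suc k)) z)
      (?c *\<^sub>R (Im z *\<^sub>R V (Suc (Suc k)) z) + ((Im z)\<^sup>2 *\<^sub>R (Im z *\<^sub>R V (Suc (Suc (Suc k))) z)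
        + (2 * Im z) *\<^sub>R V (Suc (Suc k)) z)) z"
    by (intro has_partial_deriv_add has_partial_deriv_scaleR has_partial_deriv_scaleR_const
        V_beta Suc.prems sq)
  moreover have "has_partial_deriv \<i> (\<lambda>z. ?c *\<^sub>R V (Suc k) z + (Im z)\<^sup>2 *\<^sub>R V (Suc (Suc k)) z)
      (Im z *\<^sub>R T (Suc (Suc k)) z) z"
    using T_beta[OF Suc.prems, of "Suc k"] has_partial_deriv_cong[OF U_open Suc.prems Suc.IH]
    by simp
  ultimately have "Im z *\<^sub>R T (Suc (Suc k)) z = ?c *\<^sub>R (Im z *\<^sub>R V (Suc (Suc k)) z)
      + ((Im z)\<^sup>2 *\<^sub>R (Im z *\<^sub>R V (Suc (Suc (Suc k))) z) + (2 * Im z) *\<^sub>R V (Suc (Suc k)) z)"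
    by (rule has_partial_deriv_unique[rotated])
  also have "\<dots> = Im z *\<^sub>R ((2 * real (Suc k) + 3) *\<^sub>R V (Suc (Suc k)) z
      + (Im z)\<^sup>2 *\<^sub>R V (Suc (Suc (Suc k))) z)"
    by (simp add: algebra_simps) (simp add: scaleR_add_left[symmetric])
  finally show ?case using z by simp
qed

text \<open>The beta^2 \<open>V (Suc (Suc k))\<close> from the directions x_i cancels against the
  one in \<open>T_eq\<close>. The scalar \<open>c\<close> lets the iteration apply this directly to
  its accumulated product.\<close>

lemma laplacian_V:
  fixes x :: "'m::finite paravector"
  assumes "slice_point x \<in> U"
  shows "laplacian (\<lambda>x. c *\<^sub>R V k (slice_point x)) x
    = (c * (real CARD('m) - 2 * real k - 3)) *\<^sub>R V (Suc k) (slice_point x)"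
proof -
  have b: "has_partial_deriv \<i> (\<lambda>z. c *\<^sub>R V k z) (Im z *\<^sub>R c *\<^sub>R V (Suc k) z) z" if "z \<in> U" for k z
    using has_partial_deriv_scaleR_const[OF V_beta[OF that], of c] by (simp add: mult_ac)
  have "laplacian (\<lambda>x. c *\<^sub>R V k (slice_point x)) x
    = real CARD('m) *\<^sub>R c *\<^sub>R V (Suc k) (slice_point x)
      + (beta x)\<^sup>2 *\<^sub>R c *\<^sub>R V (Suc (Suc k)) (slice_point x) + c *\<^sub>R (- T (Suc k) (slice_point x))"
    by (rule laplacian_slice_point[OF U_open assms U_pos b b
          has_partial_deriv_scaleR_const[OF V_alpha] has_partial_deriv_scaleR_const[OF V_alpha_alpha]])
  also have "T (Suc k) (slice_point x) = (2 * real k + 3) *\<^sub>R V (Suc k) (slice_point x)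
      + (beta x)\<^sup>2 *\<^sub>R V (Suc (Suc k)) (slice_point x)"
    using T_eq[OF assms] by simp
  finally show ?thesis by (simp add: algebra_simps)
qed

text \<open>Passing from k to k + 1 contributes m - 2k - 3 = m - 2(k + 1) - 1, the factor with i = k
  + 1.\<close>

lemma laplacian_funpow_eq:
  fixes g :: "'m::finite paravector \<Rightarrow> 'b"
  assumes g: "\<And>x. slice_point x \<in> U \<Longrightarrow> g x = V 0 (slice_point x)" and "slice_point x \<in> U"
  shows "(laplacian ^^ k) g x
    = (\<Prod>i=1..k. real CARD('m) - 2 * real i - 1) *\<^sub>R V k (slice_point x)"
  using assms(2)
proof (induction k arbitrary: x)
  case (Suc k)
  have "laplacian ((laplacian ^^ k) g) x
      = laplacian (\<lambda>x. (\<Prod>i=1..k. real CARD('m) - 2 * real i - 1) *\<^sub>R V k (slice_point x)) x"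
    by (rule laplacian_cong[OF open_slice_point_vimage[OF U_open]]) (use Suc in auto)
  then show ?case using laplacian_V[OF Suc.prems] by (simp add: algebra_simps)
qed (simp add: g)

text \<open>The \<open>\<beta>\<close>-derivatives of \<open>u = \<beta>\<^sup>-\<^sup>1 F\<^sub>1\<close>, obtained by solving Leibniz' rule
  \<open>\<partial>\<beta>\<^sup>j\<^sup>+\<^sup>1 (\<beta> u) = \<beta> \<partial>\<beta>\<^sup>j\<^sup>+\<^sup>1 u + (j + 1) \<partial>\<beta>\<^sup>j u\<close> for the top derivative.\<close>

primrec W :: "nat \<Rightarrow> complex \<Rightarrow> 'b"
  where "W 0 z = inverse (Im z) *\<^sub>R H 0 z"
  | "W (Suc j) z = inverse (Im z) *\<^sub>R (H (Suc j) z - real (Suc j) *\<^sub>R W j z)"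

lemma W_beta:
  assumes "z \<in> U"
  shows "has_partial_deriv \<i> (W j) (W (Suc j) z) z"
proof -
  have z: "Im z \<noteq> 0" using U_pos[OF assms] by simp
  have inv: "has_partial_deriv \<i> (\<lambda>z. inverse (Im z)) (- inverse (Im z) * inverse (Im z)) z"
    using has_partial_deriv_Im_power_int[OF has_partial_deriv_Im_ii z, of "-1"] z
    by (simp add: power_int_minus power2_eq_square)
  have W_Suc: "W (Suc j) = (\<lambda>z. inverse (Im z) *\<^sub>R (H (Suc j) z - real (Suc j) *\<^sub>R W j z))" for j
    by (simp add: fun_eq_iff)
  show ?thesis
  proof (induction j)
    case 0
    have "has_partial_deriv \<i> (\<lambda>z. inverse (Im z) *\<^sub>R H 0 z)
        (inverse (Im z) *\<^sub>R H (Suc 0) z + (- inverse (Im z) * inverse (Im z)) *\<^sub>R H 0 z) z"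
      by (intro has_partial_deriv_scaleR inv H_beta assms)
    moreover have "W 0 = (\<lambda>z. inverse (Im z) *\<^sub>R H 0 z)" by (simp add: fun_eq_iff)
    ultimately show ?case by (simp add: scaleR_diff_right)
  next
    case (Suc j)
    have "has_partial_deriv \<i> (W (Suc j))
        (inverse (Im z) *\<^sub>R (H (Suc (Suc j)) z - real (Suc j) *\<^sub>R W (Suc j) z)
        + (- inverse (Im z) * inverse (Im z)) *\<^sub>R (H (Suc j) z - real (Suc j) *\<^sub>R W j z)) z"
      by (subst W_Suc) (intro has_partial_deriv_scaleR inv has_partial_deriv_diff
          has_partial_deriv_scaleR_const H_beta assms Suc)
    \<comment> \<open>The derivative of 1 / beta reproduces \<open>W (Suc j)\<close> itself, which
      raises the Leibniz factor j + 1 to j + 2.\<close>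
    also have "(- inverse (Im z) * inverse (Im z)) *\<^sub>R (H (Suc j) z - real (Suc j) *\<^sub>R W j z)
        = - (inverse (Im z) *\<^sub>R W (Suc j) z)" by simp
    also have "inverse (Im z) *\<^sub>R (H (Suc (Suc j)) z - real (Suc j) *\<^sub>R W (Suc j) z)
        + - (inverse (Im z) *\<^sub>R W (Suc j) z) = W (Suc (Suc j)) z"
      unfolding W.simps(2)[of "Suc j"] of_nat_Suc[of "Suc j"]
      by (simp only: scaleR_diff_right scaleR_add_left scaleR_add_right scaleR_one) simp
    finally show ?case .
  qed
qed

text \<open>No identity between coefficients is needed: both sides start at the same function for k
  = 0, beta^-1 d_beta raises both by one index, and derivatives are unique.\<close>

lemma radial_sum_W_eq:
  assumes "z \<in> U"
  shows "radial_sum W (Suc k) z = V (Suc k) z"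
  using assms
proof (induction k arbitrary: z)
  case 0
  have "W 0 = V 0" by (simp add: fun_eq_iff V_0)
  then have "W 1 z = Im z *\<^sub>R V 1 z"
    using W_beta[OF 0, of 0] V_beta[OF 0, of 0] has_partial_deriv_unique by fastforce
  then show ?case using U_pos[OF 0] by (simp add: radial_sum_1 del: W.simps)
next
  case (Suc k)
  have "has_partial_deriv \<i> (radial_sum W (Suc k)) (Im z *\<^sub>R radial_sum W (Suc (Suc k)) z) z"
    using U_pos[OF Suc.prems] by (intro has_partial_deriv_radial_sum_ii W_beta Suc.prems) auto
  then have "has_partial_deriv \<i> (V (Suc k)) (Im z *\<^sub>R radial_sum W (Suc (Suc k)) z) z"
    using has_partial_deriv_cong[OF U_open Suc.prems Suc.IH] by simp
  then have "Im z *\<^sub>R radial_sum W (Suc (Suc k)) z = Im z *\<^sub>R V (Suc (Suc k)) z"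
    by (rule has_partial_deriv_unique) (rule V_beta[OF Suc.prems])
  then show ?case using U_pos[OF Suc.prems] by simp
qed

end

section \<open>Stem functions of slice regular functions\<close>

lemma has_partial_deriv_partial_deriv:
  assumes "(\<lambda>t. f (z + t *\<^sub>R v)) differentiable (at (0::real))"
  shows "has_partial_deriv v f (partial_deriv v f z) z"
  using assms unfolding has_partial_deriv_def partial_deriv_def
  by (simp add: vector_derivative_works)

lemma has_partial_deriv_shift:
  assumes "has_partial_deriv v f d (z + s *\<^sub>R v)"
  shows "((\<lambda>t. f (z + t *\<^sub>R v)) has_vector_derivative d) (at (s::real))"
proof -
  have "((\<lambda>t. f ((z + s *\<^sub>R v) + t *\<^sub>R v)) has_vector_derivative d) (at (s - s))"
    using assms by (simp add: has_partial_deriv_def)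
  moreover have "((\<lambda>t. t - s) has_vector_derivative 1) (at s)"
    by (auto intro!: derivative_eq_intros)
  ultimately have "((\<lambda>t. f ((z + s *\<^sub>R v) + t *\<^sub>R v)) \<circ> (\<lambda>t. t - s) has_vector_derivative 1 *\<^sub>R d) (at s)"
    by (intro vector_diff_chain_at)
  then show ?thesis by (simp add: o_def algebra_simps)
qed

text \<open>Continuous partial derivatives give total differentiability. The argument runs in the
  product coordinates (\<open>Re z\<close>, \<open>Im z\<close>) and is carried back by
  composition.\<close>

lemma C1_on_has_derivative:
  fixes f :: "complex \<Rightarrow> 'b::real_normed_vector"
  assumes D: "open D" "z \<in> D" and f: "C1_on D f"
  shows "(f has_derivative (\<lambda>h. Re h *\<^sub>R \<partial>\<alpha> f z + Im h *\<^sub>R \<partial>\<beta> f z)) (at z)"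
proof -
  have part: "has_partial_deriv v f (partial_deriv v f w) w" if "v \<in> {1, \<i>}" "w \<in> D" for v w
    using f that by (intro has_partial_deriv_partial_deriv) (auto simp: C1_on_def Basis_complex_def)
  have cont: "continuous_on D (\<partial>\<beta> f)"
    using f by (simp add: C1_on_def Basis_complex_def)
  let ?P = "\<lambda>p. Complex (fst p) (snd p)"
  have P: "continuous_on UNIV ?P"
    unfolding Complex_eq by (intro continuous_intros)
  have "open (?P -` D)" by (rule open_vimage[OF D(1) P])
  then obtain X Y where XY: "open X" "open Y" "(Re z, Im z) \<in> X \<times> Y" "X \<times> Y \<subseteq> ?P -` D"
    using D(2) by (elim open_prod_elim[where x = "(Re z, Im z)"]) auto
  \<comment> \<open>\<open>has_derivative_partialsI\<close> needs a convex range for the second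
    variable, hence a ball.\<close>
  then obtain e where e: "e > 0" "ball (Im z) e \<subseteq> Y" using openE[of Y "Im z"] by auto
  define Y' where "Y' = ball (Im z) e"
  have Y': "open Y'" "convex Y'" "Im z \<in> Y'" "X \<times> Y' \<subseteq> ?P -` D"
    using e XY by (auto simp: Y'_def)
  have in_D: "Complex x y \<in> D" if "x \<in> X" "y \<in> Y'" for x y using Y'(4) that by auto
  have "((\<lambda>(x, y). f (Complex x y)) has_derivative (\<lambda>(tx, ty). tx *\<^sub>R \<partial>\<alpha> f z
      + blinfun_apply (blinfun_scaleR_left (\<partial>\<beta> f (Complex (Re z) (Im z)))) ty))
      (at (Re z, Im z) within X \<times> Y')"
  proof (rule has_derivative_partialsI)
    have "((\<lambda>t. f (\<i> * Im z + t *\<^sub>R 1)) has_vector_derivative \<partial>\<alpha> f z) (at (Re z))"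
      by (rule has_partial_deriv_shift)
        (use part[of 1 z] D(2) in
          \<open>simp add: scaleR_conv_of_real add.commute flip: complex_eq\<close>)
    then show "((\<lambda>x. f (Complex x (Im z))) has_derivative (\<lambda>t. t *\<^sub>R \<partial>\<alpha> f z)) (at (Re z) within X)"
      by (auto simp: has_vector_derivative_def Complex_eq add.commute scaleR_conv_of_real
          intro: has_derivative_at_withinI)
    show "((\<lambda>y. f (Complex x y)) has_derivative
        blinfun_apply (blinfun_scaleR_left (\<partial>\<beta> f (Complex x y)))) (at y within Y')"
      if "x \<in> X" "y \<in> Y'" for x y
    proof -
      have "((\<lambda>t. f (x + t *\<^sub>R \<i>)) has_vector_derivative \<partial>\<beta> f (Complex x y)) (at y)"
        by (rule has_partial_deriv_shift)
          (use part[of \<i> "Complex x y"] in_D[OF that] in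
            \<open>simp add: Complex_eq scaleR_conv_of_real mult.commute\<close>)
      then show ?thesis
        by (auto simp: has_vector_derivative_def Complex_eq mult.commute scaleR_conv_of_real
          intro: has_derivative_at_withinI)
    qed
    have "isCont (\<partial>\<beta> f) (Complex (Re z) (Im z))"
      using cont D by (simp add: continuous_on_eq_continuous_at)
    moreover have "isCont ?P (Re z, Im z)"
      using P by (simp add: continuous_on_eq_continuous_at)
    ultimately have "isCont (\<lambda>p. \<partial>\<beta> f (?P p)) (Re z, Im z)"
      using isCont_o2[of "(Re z, Im z)" ?P "\<partial>\<beta> f"] by simp
    then have "isCont (\<lambda>p. blinfun_scaleR_left (\<partial>\<beta> f (?P p))) (Re z, Im z)"
      by (rule bounded_linear.isCont[OF bounded_linear_blinfun_scaleR_left])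
    then show "continuous (at (Re z, Im z) within X \<times> Y')
        (\<lambda>(x, y). blinfun_scaleR_left (\<partial>\<beta> f (Complex x y)))"
      by (simp add: case_prod_unfold continuous_at_imp_continuous_at_within)
  qed (use Y' in auto)
  then have "((\<lambda>(x, y). f (Complex x y)) has_derivative
      (\<lambda>(tx, ty). tx *\<^sub>R \<partial>\<alpha> f z + ty *\<^sub>R \<partial>\<beta> f z)) (at (Re z, Im z))"
    using XY(1,3) Y' by (simp add: at_within_open[OF _ open_Times])
  moreover have "((\<lambda>w. (Re w, Im w)) has_derivative (\<lambda>h. (Re h, Im h))) (at z)"
    by (auto intro!: derivative_eq_intros)
  ultimately show ?thesis
    using has_derivative_compose[of "\<lambda>w. (Re w, Im w)" "\<lambda>h. (Re h, Im h)" z UNIV] by fastforce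
qed

text \<open>The Cauchy-Riemann equations hold in each coefficient and make the real differential
  multiplication by one complex number. Holomorphy then supplies the higher derivatives that C1
  alone does not give.\<close>

lemma cauchy_riemann_holomorphic:
  fixes F0 F1 :: "complex \<Rightarrow> real ^ 'n::finite"
  assumes "open D" "C1_on D F0" "C1_on D F1"
    and CR: "\<And>z. z \<in> D \<Longrightarrow> \<partial>\<alpha> F0 z = \<partial>\<beta> F1 z \<and> \<partial>\<beta> F0 z = - \<partial>\<alpha> F1 z"
  shows "(\<lambda>z. Complex (F0 z $ A) (F1 z $ A)) holomorphic_on D"
proof (subst holomorphic_on_open[OF assms(1)], intro ballI exI)
  fix z assume z: "z \<in> D"
  let ?c = "Complex (\<partial>\<alpha> F0 z $ A) (\<partial>\<alpha> F1 z $ A)"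
  have comp: "((\<lambda>w. F w $ A) has_derivative (\<lambda>h. Re h * \<partial>\<alpha> F z $ A + Im h * \<partial>\<beta> F z $ A)) (at z)"
    if "C1_on D F" for F :: "complex \<Rightarrow> real ^ 'n"
    using bounded_linear.has_derivative[OF bounded_linear_vec_nth
        C1_on_has_derivative[OF assms(1) z that]] by simp
  have "((\<lambda>w. of_real (F0 w $ A) + \<i> * of_real (F1 w $ A)) has_derivative
      (\<lambda>h. of_real (Re h * \<partial>\<alpha> F0 z $ A + Im h * \<partial>\<beta> F0 z $ A)
        + \<i> * of_real (Re h * \<partial>\<alpha> F1 z $ A + Im h * \<partial>\<beta> F1 z $ A))) (at z)"
    by (intro has_derivative_add has_derivative_mult_right has_derivative_of_real
        comp assms(2,3))
  moreover have "of_real (Re h * \<partial>\<alpha> F0 z $ A + Im h * \<partial>\<beta> F0 z $ A)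
        + \<i> * of_real (Re h * \<partial>\<alpha> F1 z $ A + Im h * \<partial>\<beta> F1 z $ A) = ?c * h" for h
    using CR[OF z] by (simp add: complex_eq_iff algebra_simps)
  ultimately show "((\<lambda>z. Complex (F0 z $ A) (F1 z $ A)) has_field_derivative ?c) (at z)"
    by (simp add: has_field_derivative_def Complex_eq)
qed

lemma has_vector_derivative_vec_lambda:
  assumes "\<And>A. ((\<lambda>t. f t $ A) has_vector_derivative d $ A) (at t)"
  shows "(f has_vector_derivative (d :: real ^ 'n::finite)) (at t)"
  using assms unfolding has_vector_derivative_def
  by (subst has_derivative_componentwise_within) (auto simp: Basis_vec_def inner_axis)

text \<open>The factor \<open>w\<close> records the directions already used: an alpha-derivative
  multiplies it by 1, a beta-derivative by i. One formula thus covers all mixed derivatives.\<close>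

lemma has_partial_deriv_holomorphic:
  fixes g :: "'n::finite \<Rightarrow> complex \<Rightarrow> complex"
  assumes "open D" "\<And>A. g A holomorphic_on D" "z \<in> D"
  shows "has_partial_deriv v (\<lambda>z. \<chi> A. Im (w * (deriv ^^ n) (g A) z))
    (\<chi> A. Im (w * v * (deriv ^^ Suc n) (g A) z)) z"
  unfolding has_partial_deriv_def
proof (rule has_vector_derivative_vec_lambda)
  fix A
  have "((deriv ^^ n) (g A) has_field_derivative (deriv ^^ Suc n) (g A) z) (at (z + 0 *\<^sub>R v))"
    using holomorphic_derivI[OF holomorphic_higher_deriv[OF assms(2,1)] assms(1,3)] by simp
  moreover have "((\<lambda>t. z + t *\<^sub>R v) has_vector_derivative v) (at 0)"
    by (auto intro!: derivative_eq_intros)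
  ultimately have "((deriv ^^ n) (g A) \<circ> (\<lambda>t. z + t *\<^sub>R v) has_vector_derivative
      v * (deriv ^^ Suc n) (g A) z) (at 0)"
    by (intro field_vector_diff_chain_at)
  from bounded_linear.has_vector_derivative[OF bounded_linear_compose[OF bounded_linear_Im
      bounded_linear_mult_right[of w]] this]
  show "((\<lambda>t. (\<chi> A. Im (w * (deriv ^^ n) (g A) (z + t *\<^sub>R v))) $ A) has_vector_derivative
      (\<chi> A. Im (w * v * (deriv ^^ Suc n) (g A) z)) $ A) (at 0)"
    by (simp add: o_def mult.assoc)
qed

text \<open>A point of the circularization may be given with negative b; conjugation symmetry of
  \<open>D\<close> brings in |b|.\<close>

lemma slice_point_circularization:
  fixes x :: "'m::finite paravector"
  assumes "symmetric_set D" "x \<in> \<Omega> D - real_axis"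
  shows "slice_point x \<in> D \<inter> {z. Im z > 0}"
proof -
  obtain a b J where J: "Complex a b \<in> D" "J \<in> \<S>" and x: "x = (a, 0) + b *\<^sub>R J"
    using assms(2) by (auto simp: circularization_def)
  have "fst J = 0" "beta J = 1" using J(2) by (auto simp: imag_units_def beta_def)
  then have "slice_point x = Complex a \<bar>b\<bar>"
    by (simp add: complex_eq_iff x alpha_def beta_eq_norm)
  moreover have "Complex a \<bar>b\<bar> \<in> D"
  proof (cases "b \<ge> 0")
    case False
    then have "Complex a \<bar>b\<bar> = cnj (Complex a b)" by (simp add: complex_eq_iff)
    then show ?thesis using assms(1) J(1) by (simp add: symmetric_set_def)
  qed (use J in simp)
  moreover have "beta x > 0" using assms(2) by (simp add: beta_eq_norm real_axis_def)
  ultimately show ?thesis using slice_point_sel(2)[of x] by auto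
qed

theorem proposition3p1:
  fixes D :: "complex set" and m :: nat
    and F0 F1 :: "complex \<Rightarrow> 'm::{finite,linorder} clifford"
    and f :: "'m paravector \<Rightarrow> 'm clifford"
  assumes "m = CARD('m)" and "odd m"
    and "open D" and "symmetric_set D"
    and "stem_function D F0 F1" and "induced_by D F0 F1 f"
    and "slice_regular D f"
  shows "(\<forall>k\<ge>1. \<forall>x\<in>\<Omega> D - real_axis.
      (laplacian ^^ k) (sph_deriv D f) x =
        (\<Prod>i=1..k. real m - 2 * real i - 1) *\<^sub>R
        (\<Sum>j=1..k. (a_coeff k j * beta x powi (int j - 2 * int k)) *\<^sub>R
          (\<partial>\<beta> ^^ j) (sph_deriv_plane D f) (Complex (alpha x) (beta x))) \<and>
      (laplacian ^^ k) (sph_deriv D f) x =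
        (\<Prod>i=1..k. real m - 2 * real i - 1) *\<^sub>R
        (\<Sum>j=1..k+1. (a_coeff (k + 1) j * beta x powi (int j - 2 * int k - 2)) *\<^sub>R
          (\<partial>\<beta> ^^ (j - 1)) F1 (Complex (alpha x) (beta x)))) \<and>
    (m \<ge> 3 \<longrightarrow> (\<forall>x\<in>\<Omega> D - real_axis.
      (laplacian ^^ ((m - 1) div 2)) (sph_deriv D f) x = 0))"
proof -
  \<comment> \<open>Regularity provides its own C1 stem function, which need not be the given one;
    the second components agree on \<open>D\<close>.\<close>
  obtain G0 G1 where G: "stem_function D G0 G1" "induced_by D G0 G1 f"
      "C1_on D G0" "C1_on D G1"
      "\<And>z. z \<in> D \<Longrightarrow> \<partial>\<alpha> G0 z = \<partial>\<beta> G1 z \<and> \<partial>\<beta> G0 z = - \<partial>\<alpha> G1 z"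
    using assms(7) unfolding slice_regular_def by blast
  have stem: "stem1 D f z = G1 z" if "z \<in> D" for z
    by (rule stem1_eq[OF assms(4) G(1,2) that])
  have F1: "F1 z = G1 z" if "z \<in> D" for z
    using stem[OF that] stem1_eq[OF assms(4-6) that] by simp
  define g where "g A z = Complex (G0 z $ A) (G1 z $ A)" for A z
  have g: "g A holomorphic_on D" for A
    unfolding g_def by (rule cauchy_riemann_holomorphic[OF assms(3) G(3-5)])
  define L where "L w n z = (\<chi> A. Im (w * (deriv ^^ n) (g A) z))" for w n z
  have L: "has_partial_deriv v (L w n) (L (w * v) (Suc n) z) z" if "z \<in> D" for v w n z
    unfolding L_def by (rule has_partial_deriv_holomorphic[OF assms(3) g that])
  define U where "U = D \<inter> {z. Im z > 0}"
  \<comment> \<open>By \<open>L\<close>, each beta-derivative adds a factor i and one complex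
    derivative, so \<open>L\<close> at i^j and \<open>j\<close> is the j-th beta-derivative of
    \<open>G1\<close>.\<close>
  interpret harmonic_jet U "\<lambda>j. L (\<i> ^ j) j" "\<lambda>j. L (\<i> ^ j) (Suc j)"
  proof
    show "open U" unfolding U_def by (intro open_Int assms(3) open_halfspace_Im_gt)
    fix z j assume "z \<in> U"
    then have z: "z \<in> D" and pos: "Im z > 0" by (auto simp: U_def)
    show "Im z > 0" by (rule pos)
    show "has_partial_deriv \<i> (L (\<i> ^ j) j) (L (\<i> ^ Suc j) (Suc j) z) z"
      using L[OF z, of \<i> "\<i> ^ j" j] by (simp add: mult.commute)
    show "has_partial_deriv 1 (L (\<i> ^ j) j) (L (\<i> ^ j) (Suc j) z) z"
      using L[OF z, of 1 "\<i> ^ j" j] by simp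
    \<comment> \<open>Harmonicity is just i^2 = -1: two alpha-derivatives leave i^j, two
      beta-derivatives give i^(j+2).\<close>
    have "L (\<i> ^ j) (Suc (Suc j)) z = - L (\<i> ^ Suc (Suc j)) (Suc (Suc j)) z"
      by (simp add: L_def vec_eq_iff mult.assoc[symmetric])
    then show "has_partial_deriv 1 (L (\<i> ^ j) (Suc j)) (- L (\<i> ^ Suc (Suc j)) (Suc (Suc j)) z) z"
      using L[OF z, of 1 "\<i> ^ j" "Suc j"] by simp
  qed
  have L_0: "L (\<i> ^ 0) 0 z = G1 z" for z by (simp add: L_def g_def vec_eq_iff)
  have plane: "sph_deriv_plane D f z = W 0 z" if "z \<in> U" for z
    using that stem[of z] L_0[of z] by (simp add: U_def sph_deriv_plane_def)
  have lap: "(laplacian ^^ k) (sph_deriv D f) x = (\<Prod>i=1..k. real m - 2 * real i - 1) *\<^sub>R V k (slice_point x)"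
    if "slice_point x \<in> U" for k x
    unfolding assms(1)
  proof (rule laplacian_funpow_eq[OF _ that])
    show "sph_deriv D f y = V 0 (slice_point y)" if "slice_point y \<in> U" for y
      using plane[OF that] by (simp add: sph_deriv_def V_0 slice_point_def)
  qed
  have U: "slice_point x \<in> U" if "x \<in> \<Omega> D - real_axis" for x :: "'m paravector"
    unfolding U_def by (rule slice_point_circularization[OF assms(4) that])
  have first: "V k (slice_point x) = (\<Sum>j=1..k. (a_coeff k j * beta x powi (int j - 2 * int k)) *\<^sub>R
      (\<partial>\<beta> ^^ j) (sph_deriv_plane D f) (slice_point x))"
    if "k \<ge> 1" "slice_point x \<in> U" for k and x :: "'m paravector"
    using radial_sum_W_eq[OF that(2), of "k - 1"] that
      funpow_partial_deriv_eq[where U = W, OF U_open plane W_beta that(2)]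
    by (simp add: radial_sum_def)
  have second: "V k (slice_point x)
      = (\<Sum>j=1..k+1. (a_coeff (k + 1) j * beta x powi (int j - 2 * int k - 2)) *\<^sub>R
          (\<partial>\<beta> ^^ (j - 1)) F1 (slice_point x))"
    if "slice_point x \<in> U" for k and x :: "'m paravector"
  proof -
    have "F1 z = L (\<i> ^ 0) 0 z" if "z \<in> U" for z
      using that F1[of z] L_0[of z] by (simp add: U_def)
    from funpow_partial_deriv_eq[where U = "\<lambda>j. L (\<i> ^ j) j", OF U_open this H_beta that]
    show ?thesis by (simp add: V_def radial_sum_def algebra_simps)
  qed
  have vanish: "(\<Prod>i=1..(m - 1) div 2. real m - 2 * real i - 1) = 0" if "m \<ge> 3"
  proof -
    \<comment> \<open>The factor with i = l is m - 2l - 1 = 0, and m >= 3 puts l in the range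
      1..l.\<close>
    obtain l where "m = 2 * l + 1" using assms(2) by (elim oddE)
    with that show ?thesis by (intro prod_zero bexI[of _ l]) auto
  qed
  show ?thesis
    unfolding slice_point_def[symmetric]
    using lap[OF U] first[OF _ U] second[OF U] vanish by simp
qed

end
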